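(* Let $d\ge1$ and let $S\subset M_d(\mathbb{C})$ be a bounded subset with $\rho(S)=1$. Set $n_0(d)=3^d4^{d^2}$ and let $\varepsilon>0$. If $n$ is an integer with $n\ge \varepsilon^{-d^2}n_0(d)$, then $$\max_{1\le k\le n}\Lambda(S^k)\ge 1-\varepsilon.$$
   Context: $M_d(\mathbb{C})$ is the ring of $d\times d$ complex matrices. For $S\subset M_d(\mathbb{C})$ and $k\ge1$, $S^k:=\{s_1\cdots s_k : s_i\in S\}$ is the $k$-fold product set. Given a norm $\|\cdot\|$ on $\mathbb{C}^d$, the same symbol denotes its associated operator norm on $M_d(\mathbb{C})$, and $\|S\|:=\sup_{s\in S}\|s\|$. The joint spectral radius of a bounded set $S$ is $\rho(S):=\lim_{n\to+\infty}\|S^n\|^{1/n}$ (the limit exists and does not depend on the norm). For $s\in M_d(\mathbb{C})$, $\Lambda(s)$ is the largest modulus of an eigenvalue of $s$, and $\Lambda(S):=\sup_{s\in S}\Lambda(s)$. *)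

theory Defs
  imports "HOL-Analysis.Analysis"
begin

(* Matrix products are written with **; the operation * on complex^'n^'n is entrywise. *)

definition prod_set :: "(complex^'n^'n) set \<Rightarrow> nat \<Rightarrow> (complex^'n^'n) set" where
  "prod_set S k = {foldr (**) ss (mat 1) | ss. length ss = k \<and> set ss \<subseteq> S}"

(* Supremum of a set of nonnegative reals, taken in [0, infinity): inserting 0 only
   fixes the value on the empty set, where Sup on the reals is unspecified. *)
definition nonneg_Sup :: "real set \<Rightarrow> real" where
  "nonneg_Sup X = Sup (insert 0 X)"

(* Operator norm associated with the Euclidean (Hermitian) norm on complex^'n.  The joint
   spectral radius below does not depend on the choice of the norm. *)
definition op_norm :: "complex^'n^'n \<Rightarrow> real" where
  "op_norm A = onorm (\<lambda>v. A *v v)"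

definition set_norm :: "(complex^'n^'n) set \<Rightarrow> real" where
  "set_norm S = nonneg_Sup (op_norm ` S)"

definition joint_spectral_radius :: "(complex^'n^'n) set \<Rightarrow> real" where
  "joint_spectral_radius S = lim (\<lambda>n. root n (set_norm (prod_set S n)))"

(* The scalar multiplication of vectors by complex numbers is *s. *)
definition eigenvalues :: "complex^'n^'n \<Rightarrow> complex set" where
  "eigenvalues A = {l. \<exists>v. v \<noteq> 0 \<and> A *v v = l *s v}"

definition max_eigenvalue_modulus :: "complex^'n^'n \<Rightarrow> real" where
  "max_eigenvalue_modulus A = Max (cmod ` eigenvalues A)"

definition sup_eigenvalue_modulus :: "(complex^'n^'n) set \<Rightarrow> real" where
  "sup_eigenvalue_modulus S = nonneg_Sup (max_eigenvalue_modulus ` S)"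

definition n0 :: "nat \<Rightarrow> nat" where
  "n0 d = 3 ^ d * 4 ^ (d\<^sup>2)"

end

theory Submission
  imports Defs "HOL-Computational_Algebra.Fundamental_Theorem_Algebra"
begin

text \<open>
  Suppose that all eigenvalues of products of length at most \<open>n\<close> have modulus at most
  \<open>R < 1 - \<epsilon>\<close>.  For \<open>t < 1\<close> close to 1 the norm \<open>p v = sup {t\<^sup>k \<parallel>w v\<parallel> | w \<in> S\<^sup>k}\<close> is
  contracted by \<open>t S\<close>, and since \<open>\<parallel>S\<^sup>k\<parallel> \<ge> 1\<close> for all \<open>k\<close>, there is an orbit of \<open>t S\<close> of
  length \<open>n\<close> along which \<open>p\<close> stays close to 1.  A contraction \<open>f\<close> of \<open>p\<close> with spectral
  radius at most \<open>r\<close> satisfies \<open>(1 - r) p x \<le> C p (x - f x)\<close>, where \<open>C\<close> depends on \<open>r\<close>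
  and \<open>d\<close> only.  Here it is essential that this is linear in \<open>1 - r\<close>: estimating \<open>det (1 - f)\<close>
  would only give the power \<open>(1 - r)\<^sup>d\<close>.  Hence distinct points of the orbit, even up to phases, have
  distance at least \<open>\<epsilon> / C\<close>, and comparing volumes in real dimension \<open>2 d\<close> bounds \<open>n\<close> by a
  multiple of \<open>\<epsilon> powr (- 2 d)\<close>.  This is good enough for \<open>d \<ge> 2\<close> because \<open>2 d \<le> d\<^sup>2\<close>; in dimension 1
  the orbit contracts by the factor \<open>R\<close> in its first step.
\<close>

section \<open>Packing in an arbitrary norm\<close>

text \<open>The lower comparison constant is normalized to 1 because the norm constructed later is a
  supremum that has the Euclidean norm among its terms. The upper bound gives continuity, hence open
  balls whose volumes can be compared.\<close>

locale equivalent_norm =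
  fixes p :: "complex^'n \<Rightarrow> real" and K :: real
  assumes triangle: "p (x + y) \<le> p x + p y"
    and scale: "p (c *s x) = cmod c * p x"
    and norm_le: "norm x \<le> p x"
    and le_norm: "p x \<le> K * norm x"
begin

lemma nonneg [simp]: "0 \<le> p x"
  using norm_le[of x] norm_ge_zero[of x] by linarith

lemma zero [simp]: "p 0 = 0"
  using scale[of 0 0] by simp

lemma eq_0D: "p x = 0 \<Longrightarrow> x = 0"
  using norm_le[of x] by simp

lemma minus: "p (- x) = p x"
  using scale[of "-1" x] by (simp add: vec.scale_minus_left)

lemma diff_commute: "p (x - y) = p (y - x)"
  using minus[of "x - y"] by simp

lemma triangle_diff: "p (x - y) \<le> p x + p y"
  using triangle[of x "- y"] by (simp add: minus)

lemma scaleR: "p (r *\<^sub>R x) = \<bar>r\<bar> * p x"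
proof -
  have "r *\<^sub>R x = complex_of_real r *s x"
    by (simp only: vec_eq_iff vector_scaleR_component vector_smult_component)
      (simp add: scaleR_conv_of_real)
  then show ?thesis by (simp add: scale)
qed

lemma continuous_on: "continuous_on UNIV p"
proof (rule continuous_onI)
  fix x :: "complex^'n" and e :: real
  assume e: "e > 0"
  \<comment> \<open>\<open>K\<close> carries no sign assumption, while
    \<open>\<bar>K\<bar> + 1\<close> is positive and can be divided by.\<close>
  have K: "\<bar>p y - p x\<bar> \<le> (\<bar>K\<bar> + 1) * norm (y - x)" for y
  proof -
    have "p y \<le> p (y - x) + p x" "p x \<le> p (x - y) + p y"
      using triangle[of "y - x" x] triangle[of "x - y" y] by auto
    then have "\<bar>p y - p x\<bar> \<le> p (y - x)" by (simp add: diff_commute[of x y])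
    also have "\<dots> \<le> K * norm (y - x)" by (rule le_norm)
    also have "\<dots> \<le> (\<bar>K\<bar> + 1) * norm (y - x)" by (rule mult_right_mono) auto
    finally show ?thesis .
  qed
  show "\<exists>d>0. \<forall>x'\<in>UNIV. dist x' x < d \<longrightarrow> dist (p x') (p x) \<le> e"
  proof (intro exI[of _ "e / (\<bar>K\<bar> + 1)"] conjI ballI impI)
    show "0 < e / (\<bar>K\<bar> + 1)" using e by simp
    fix y assume "dist y x < e / (\<bar>K\<bar> + 1)"
    then have "(\<bar>K\<bar> + 1) * norm (y - x) < e"
      by (simp add: dist_norm pos_less_divide_eq mult.commute add_nonneg_pos)
    with K[of y] show "dist (p y) (p x) \<le> e" by (simp add: dist_real_def)
  qed
qed

text \<open>The \<open>p\<close>-balls of radius \<open>\<delta>/2\<close> around the points are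
  disjoint and lie in the ball of radius \<open>1 + \<delta>/2\<close> around 0. Volumes scale with
  the real dimension, which is twice the complex one.\<close>

lemma card_separated_le:
  fixes y :: "'i \<Rightarrow> complex^'n"
  assumes fin: "finite I" and \<delta>: "\<delta> > 0"
    and unit: "\<And>i. i \<in> I \<Longrightarrow> p (y i) \<le> 1"
    and sep: "\<And>i j. i \<in> I \<Longrightarrow> j \<in> I \<Longrightarrow> i \<noteq> j \<Longrightarrow> \<delta> \<le> p (y i - y j)"
  shows "real (card I) \<le> (1 + 2 / \<delta>) ^ (2 * CARD('n))"
proof -
  define B where "B a r = {v. p (v - a) < r}" for a :: "complex^'n" and r
  define D where "D = 2 * CARD('n)"
  have B_open: "open (B a r)" for a r
  proof -
    have "continuous_on UNIV (\<lambda>v. p (v - a))"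
      by (rule continuous_on_compose2[OF continuous_on]) (auto intro: continuous_on_diff)
    then show ?thesis unfolding B_def by (rule open_Collect_less) (rule continuous_on_const)
  qed
  have B_bounded: "bounded (B a r)" for a r
  proof -
    have "B a r \<subseteq> cball a r"
    proof
      fix v assume "v \<in> B a r"
      then show "v \<in> cball a r"
        using norm_le[of "v - a"] by (simp add: B_def dist_norm norm_minus_commute)
    qed
    then show ?thesis using bounded_cball bounded_subset by blast
  qed
  have B_meas: "B a r \<in> lmeasurable" for a r
    by (rule lmeasurable_open[OF B_bounded B_open])
  have B_measure: "measure lebesgue (B a r) = r ^ D * measure lebesgue (B 0 1)" if "r > 0" for a r
  proof -
    have "B a r = (\<lambda>x. r *\<^sub>R x + a) ` B 0 1"
    proof (intro set_eqI iffI)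
      fix v assume "v \<in> B a r"
      then have "p ((1 / r) *\<^sub>R (v - a)) < 1"
        unfolding scaleR using that by (simp add: B_def)
      then have "(1 / r) *\<^sub>R (v - a) \<in> B 0 1" by (simp add: B_def)
      moreover have "v = r *\<^sub>R ((1 / r) *\<^sub>R (v - a)) + a" using that by simp
      ultimately show "v \<in> (\<lambda>x. r *\<^sub>R x + a) ` B 0 1" by blast
    next
      fix v assume "v \<in> (\<lambda>x. r *\<^sub>R x + a) ` B 0 1"
      then show "v \<in> B a r" using that by (auto simp: B_def scaleR)
    qed
    then show ?thesis
      using measure_lebesgue_affine[of r a "B 0 1"] that by (simp add: D_def mult.commute)
  qed
  have pos: "measure lebesgue (B 0 1) > 0"
  proof -
    have "0 \<in> B 0 1" by (simp add: B_def)
    then have "\<not> negligible (B 0 1)" by (intro open_not_negligible B_open) auto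
    then show ?thesis
      using negligible_iff_measure0[OF B_meas, of 0 1] by (simp add: zero_less_measure_iff)
  qed
  have "real (card I) * ((\<delta>/2) ^ D * measure lebesgue (B 0 1))
      = (\<Sum>i\<in>I. measure lebesgue (B (y i) (\<delta>/2)))"
    using \<delta> by (simp add: B_measure[where r = "\<delta>/2"])
  also have "\<dots> = measure lebesgue (\<Union>i\<in>I. B (y i) (\<delta>/2))"
  proof (rule measure_UNION'[symmetric, OF fin B_meas], rule pairwiseI)
    fix i j assume ij: "i \<in> I" "j \<in> I" "i \<noteq> j"
    have False if "v \<in> B (y i) (\<delta>/2)" "v \<in> B (y j) (\<delta>/2)" for v
      using sep[OF ij] triangle_diff[of "v - y j" "v - y i"] that by (simp add: B_def)
    then show "disjnt (B (y i) (\<delta>/2)) (B (y j) (\<delta>/2))" by (auto simp: disjnt_def)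
  qed
  also have "\<dots> \<le> measure lebesgue (B 0 (1 + \<delta>/2))"
  proof (rule measure_mono_fmeasurable[OF _ _ B_meas])
    show "(\<Union>i\<in>I. B (y i) (\<delta>/2)) \<subseteq> B 0 (1 + \<delta>/2)"
    proof
      fix v assume "v \<in> (\<Union>i\<in>I. B (y i) (\<delta>/2))"
      then obtain i where "i \<in> I" "v \<in> B (y i) (\<delta>/2)" by auto
      then show "v \<in> B 0 (1 + \<delta>/2)"
        using unit[of i] triangle[of "v - y i" "y i"] by (simp add: B_def)
    qed
    show "(\<Union>i\<in>I. B (y i) (\<delta>/2)) \<in> sets lebesgue"
      using fin B_meas by (intro sets.finite_UN) (auto simp: fmeasurable_def)
  qed
  also have "\<dots> = (1 + \<delta>/2) ^ D * measure lebesgue (B 0 1)"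
    using \<delta> by (intro B_measure) simp
  finally have "real (card I) * (\<delta>/2) ^ D \<le> (1 + \<delta>/2) ^ D"
    using pos by simp
  then have "real (card I) \<le> (1 + \<delta>/2) ^ D / (\<delta>/2) ^ D"
    using \<delta> by (simp add: pos_le_divide_eq)
  also have "\<dots> = ((1 + \<delta>/2) / (\<delta>/2)) ^ D" by (simp only: power_divide)
  also have "(1 + \<delta>/2) / (\<delta>/2) = 1 + 2 / \<delta>" using \<delta> by (simp add: field_simps)
  finally show ?thesis by (simp add: D_def)
qed

end

section \<open>Resolvent bounds for contractions\<close>

text \<open>The constant for at most \<open>Suc k\<close> eigenvalues. The recursion records the
  cost of removing one of them: \<open>1 + 2 * r\<close> bounds the Blaschke factor, and
  \<open>1 + r\<close> is the error of replacing \<open>x\<close> by its image under that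
  factor.\<close>

fun resolvent_const :: "real \<Rightarrow> nat \<Rightarrow> real" where
  "resolvent_const r 0 = 1"
| "resolvent_const r (Suc k) = (1 + r) + (1 + 2 * r) * resolvent_const r k"

lemma resolvent_const_ge_1: "0 \<le> r \<Longrightarrow> 1 \<le> resolvent_const r k"
proof (induction k)
  case (Suc k)
  then have "1 * 1 \<le> (1 + 2 * r) * resolvent_const r k" by (intro mult_mono) auto
  with Suc show ?case by simp
qed simp

lemma resolvent_const_mono:
  assumes "0 \<le> r" "r \<le> s"
  shows "resolvent_const r k \<le> resolvent_const s k"
proof (induction k)
  case (Suc k)
  have "0 \<le> resolvent_const r k" using resolvent_const_ge_1[OF assms(1), of k] by simp
  then have "(1 + 2 * r) * resolvent_const r k \<le> (1 + 2 * s) * resolvent_const s k"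
    using assms Suc by (intro mult_mono) auto
  with assms show ?case by simp
qed simp

text \<open>A product of operators \<open>f - \<mu>\<close> with the head of the list acting first.
  A list allows repeated roots, and for linear \<open>f\<close> its order is immaterial.\<close>

definition linear_factors :: "(complex^'n \<Rightarrow> complex^'n) \<Rightarrow> complex list \<Rightarrow> complex^'n \<Rightarrow> complex^'n" where
  "linear_factors f = fold (\<lambda>\<mu> v. f v - \<mu> *s v)"

lemma linear_factors_Nil [simp]: "linear_factors f [] x = x"
  and linear_factors_Cons [simp]:
    "linear_factors f (\<mu> # \<mu>s) x = linear_factors f \<mu>s (f x - \<mu> *s x)"
  by (simp_all add: linear_factors_def)

lemma linear_factors_commute:
  assumes "\<And>\<mu> v. f (g v) - \<mu> *s g v = g (f v - \<mu> *s v)"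
  shows "linear_factors f \<mu>s (g x) = g (linear_factors f \<mu>s x)"
  by (induction \<mu>s arbitrary: x) (simp_all add: assms)

text \<open>
  The induction removes one eigenvalue \<open>\<lambda>\<close> by applying the Blaschke factor
  \<open>b = (f - \<lambda>) (1 - cnj \<lambda> f)\<inverse>\<close>.  It has norm at most \<open>1 + 2 r\<close>, and
  \<open>1 - (1 - cnj \<lambda>) / (1 - \<lambda>) b\<close> is a multiple of \<open>1 - f\<close>.
\<close>

lemma (in equivalent_norm) resolvent_bound:
  assumes lin: "Vector_Spaces.linear (*s) (*s) f"
    and contr: "\<And>v. p (f v) \<le> p v"
    and r: "0 \<le> r" "r < 1"
    and \<mu>s: "\<And>\<mu>. \<mu> \<in> set \<mu>s \<Longrightarrow> cmod \<mu> \<le> r" "length \<mu>s \<le> Suc k"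
    and ann: "linear_factors f \<mu>s x = 0"
  shows "(1 - r) * p x \<le> resolvent_const r k * p (x - f x)"
  using \<mu>s ann
proof (induction k arbitrary: \<mu>s x)
  case 0
  show ?case
  proof (cases \<mu>s)
    case Nil
    with 0 show ?thesis by simp
  next
    case (Cons \<mu> l)
    with 0 have \<mu>: "f x = \<mu> *s x" "cmod \<mu> \<le> r" by auto
    then have *: "x - f x = (1 - \<mu>) *s x" by (simp add: vec.scale_left_diff_distrib)
    have "1 - r \<le> cmod (1 - \<mu>)" using norm_triangle_ineq2[of 1 \<mu>] \<mu>(2) by simp
    then show ?thesis unfolding * scale by (simp add: mult_right_mono)
  qed
next
  case (Suc k)
  have f_add: "f (u + v) = f u + f v" and f_scale: "f (c *s u) = c *s f u"
    and f_diff: "f (u - v) = f u - f v" and f0: "f 0 = 0" for u v c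
    using vec.linear_add[OF lin] vec.linear_scale[OF lin] vec.linear_diff[OF lin]
      vec.linear_0[OF lin] by auto
  show ?case
  proof (cases \<mu>s)
    case Nil
    with Suc.prems have "x = 0" by simp
    with f0 show ?thesis by simp
  next
    case (Cons \<mu> l)
    define a where "a = cmod \<mu>"
    have a: "0 \<le> a" "a \<le> r" "a < 1" using Suc.prems(1)[of \<mu>] Cons r by (auto simp: a_def)
    define g where "g v = v - cnj \<mu> *s f v" for v
    have g_lin: "Vector_Spaces.linear (*s) (*s) g"
      by unfold_locales
        (simp_all add: g_def f_add f_scale vec.scale_right_distrib vec.scale_right_diff_distrib
          mult.commute)
    have g_lower: "p v \<le> p (g v) / (1 - a)" for v
    proof -
      have "p v \<le> p (g v) + p (cnj \<mu> *s f v)"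
        using triangle[of "g v" "cnj \<mu> *s f v"] by (simp add: g_def)
      also have "p (cnj \<mu> *s f v) \<le> a * p v" by (simp add: scale a_def mult_left_mono contr)
      finally show ?thesis using a by (simp add: pos_le_divide_eq algebra_simps)
    qed
    have g_0D: "v = 0" if "g v = 0" for v
      using g_lower[of v] that eq_0D[of v] by simp (metis nonneg order_antisym)
    \<comment> \<open>The lower bound \<open>g_lower\<close> makes \<open>g\<close> injective, and
      finite dimension then makes it invertible.\<close>
    have "inj g" using vec.linear_inj_iff_eq_0[OF g_lin] g_0D by blast
    then have "surj g" using vec.linear_inj_imp_surj[OF g_lin] by blast
    then obtain u where u: "g u = x" by (metis surjD)
    \<comment> \<open>\<open>y\<close> is the Blaschke factor applied to \<open>x\<close>, and
      \<open>w\<close> turns out to be the preimage of \<open>x - f x\<close> under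
      \<open>g\<close>.\<close>
    define y where "y = f u - \<mu> *s u"
    define w where "w = u - f u"
    define P where "P = p (x - f x)"
    have gw: "g w = x - f x"
      unfolding w_def u[symmetric] by (simp add: g_def f_diff f_scale vec.scale_right_diff_distrib)
    have pw: "p w \<le> P / (1 - a)" using g_lower[of w] by (simp add: gw P_def)
    have norm_\<mu>: "\<mu> * cnj \<mu> = complex_of_real (a\<^sup>2)" "cnj \<mu> * \<mu> = complex_of_real (a\<^sup>2)"
      using complex_norm_square[of \<mu>] by (simp_all add: a_def mult.commute)
    have cmod_defect: "cmod (1 - complex_of_real (a\<^sup>2)) = (1 - a) * (1 + a)"
    proof -
      have "1 - complex_of_real (a\<^sup>2) = complex_of_real ((1 - a) * (1 + a))"
        by (simp add: power2_eq_square algebra_simps)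
      then show ?thesis using a by (simp only: norm_of_real) simp
    qed
    \<comment> \<open>\<open>g\<close> commutes with all factors, so
      \<open>g y = f x - \<mu> *s x\<close> is killed by the shorter list \<open>l\<close>;
      injectivity of \<open>g\<close> passes this on to \<open>y\<close>.\<close>
    have "linear_factors f l y = 0"
    proof (rule g_0D)
      have "g (linear_factors f l y) = linear_factors f l (g y)"
        by (rule linear_factors_commute[symmetric])
          (simp add: g_def f_diff f_scale vec.scale_right_diff_distrib mult.commute)
      also have "g y = f x - \<mu> *s x"
        unfolding y_def u[symmetric]
        by (simp add: g_def f_diff f_scale vec.scale_right_diff_distrib mult.commute)
      finally show "g (linear_factors f l y) = 0" using Suc.prems(3) Cons by simp
    qed
    then have IH: "(1 - r) * p y \<le> resolvent_const r k * p (y - f y)"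
      using Suc.prems Cons by (intro Suc.IH[of l]) auto
    \<comment> \<open>The left side is \<open>f w - \<mu> *s w\<close>. Written this way, the defect
      \<open>1 - a\<^sup>2\<close> cancels the loss \<open>1 / (1 - a)\<close> in the bound for
      \<open>w\<close>, which is why no second factor \<open>1 - r\<close> is lost.\<close>
    have "y - f y = (1 - complex_of_real (a\<^sup>2)) *s f w - \<mu> *s g w"
      unfolding norm_\<mu>[symmetric] y_def w_def g_def
      by (simp add: f_diff f_scale vec.scale_right_diff_distrib vec.scale_left_diff_distrib)
    then have "p (y - f y) \<le> (1 - a) * (1 + a) * p (f w) + a * P"
      using triangle_diff[of "(1 - complex_of_real (a\<^sup>2)) *s f w" "\<mu> *s g w"]
      by (simp only: scale cmod_defect gw P_def a_def[symmetric])
    also have "(1 - a) * (1 + a) * p (f w) \<le> (1 - a) * (1 + a) * (P / (1 - a))"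
      using a contr[of w] pw by (intro mult_left_mono) auto
    also have "\<dots> = (1 + a) * P" using a by simp
    finally have py: "p (y - f y) \<le> (1 + 2 * a) * P" by (simp add: algebra_simps)
    have ineq_a: "1 - a \<le> cmod (1 - \<mu>)" using norm_triangle_ineq2[of 1 \<mu>] by (simp add: a_def)
    \<comment> \<open>The two coefficients on the left have equal modulus, so the identity bounds
      \<open>p x - p y\<close> with the single weight \<open>cmod (1 - \<mu>)\<close>. The defect
      cancels the denominator again.\<close>
    have "(1 - \<mu>) *s x - cnj (1 - \<mu>) *s y = (1 - complex_of_real (a\<^sup>2)) *s w"
      unfolding norm_\<mu>[symmetric] y_def w_def u[symmetric] g_def
      by (simp add: vec_eq_iff algebra_simps)
    then have "(1 - \<mu>) *s x = cnj (1 - \<mu>) *s y + (1 - complex_of_real (a\<^sup>2)) *s w"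
      by (simp add: algebra_simps)
    then have "cmod (1 - \<mu>) * p x \<le> cmod (1 - \<mu>) * p y + (1 - a) * (1 + a) * p w"
      using triangle[of "cnj (1 - \<mu>) *s y" "(1 - complex_of_real (a\<^sup>2)) *s w"] scale[of "1 - \<mu>" x]
      by (simp only: scale cmod_defect complex_mod_cnj)
    also have "(1 - a) * (1 + a) * p w \<le> (1 - a) * (1 + a) * (P / (1 - a))"
      using a pw by (intro mult_left_mono) auto
    also have "\<dots> = (1 + a) * P" using a by simp
    finally have "cmod (1 - \<mu>) * (p x - p y) \<le> (1 + a) * P" by (simp add: algebra_simps)
    \<comment> \<open>The weight can be lowered from \<open>cmod (1 - \<mu>)\<close> to
      \<open>1 - r\<close> only when \<open>p x - p y\<close> is nonnegative; otherwise the bound is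
      trivial.\<close>
    then have *: "(1 - r) * (p x - p y) \<le> (1 + r) * P"
    proof (cases "p x \<le> p y")
      case True
      then have "(1 - r) * (p x - p y) \<le> 0" using r by (intro mult_nonneg_nonpos) auto
      also have "0 \<le> (1 + r) * P" using r by (simp add: P_def)
      finally show ?thesis .
    next
      case False
      then have "(1 - r) * (p x - p y) \<le> cmod (1 - \<mu>) * (p x - p y)"
        using ineq_a a by (intro mult_right_mono) auto
      also have "\<dots> \<le> (1 + a) * P" by fact
      also have "\<dots> \<le> (1 + r) * P" using a by (intro mult_right_mono) (auto simp: P_def)
      finally show ?thesis .
    qed
    have "(1 - r) * p y \<le> resolvent_const r k * ((1 + 2 * r) * P)"
    proof (rule order_trans[OF IH])
      have "(1 + 2 * a) * P \<le> (1 + 2 * r) * P" using a by (intro mult_right_mono) (auto simp: P_def)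
      with py show "resolvent_const r k * p (y - f y) \<le> resolvent_const r k * ((1 + 2 * r) * P)"
        using resolvent_const_ge_1[OF r(1), of k] by (intro mult_left_mono) auto
    qed
    with * show ?thesis by (simp add: P_def algebra_simps)
  qed
qed

section \<open>Eigenvalues\<close>

text \<open>Horner's scheme for the operator \<open>q(f)\<close>, carried out on a vector so that no
  ring of operators enters.\<close>

definition poly_apply :: "(complex^'n \<Rightarrow> complex^'n) \<Rightarrow> complex poly \<Rightarrow> complex^'n \<Rightarrow> complex^'n" where
  "poly_apply f q v = fold_coeffs (\<lambda>a w. a *s v + f w) q 0"

context
  fixes f :: "complex^'n \<Rightarrow> complex^'n"
  assumes lin: "Vector_Spaces.linear (*s) (*s) f"
begin

private lemma f_add: "f (u + v) = f u + f v"
  and f_scale: "f (c *s u) = c *s f u"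
  and f_diff: "f (u - v) = f u - f v"
  and f_0: "f 0 = 0"
  using vec.linear_add[OF lin] vec.linear_scale[OF lin] vec.linear_diff[OF lin] vec.linear_0[OF lin]
  by auto

lemma poly_apply_0 [simp]: "poly_apply f 0 v = 0"
  by (simp add: poly_apply_def)

lemma poly_apply_pCons [simp]: "poly_apply f (pCons a q) v = a *s v + f (poly_apply f q v)"
  by (cases "q = 0 \<and> a = 0") (auto simp: poly_apply_def f_0)

lemma poly_apply_add: "poly_apply f (q + s) v = poly_apply f q v + poly_apply f s v"
  by (induction q s rule: poly_induct2) (simp_all add: f_add vec.scale_left_distrib)

lemma poly_apply_smult: "poly_apply f (smult c q) v = c *s poly_apply f q v"
  by (induction q) (simp_all add: f_scale vec.scale_right_distrib)

lemma poly_apply_monom: "poly_apply f (monom c i) v = c *s (f ^^ i) v"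
  by (induction i) (simp_all add: monom_0 monom_Suc f_0 f_scale)

lemma poly_apply_sum: "finite I \<Longrightarrow> poly_apply f (\<Sum>i\<in>I. q i) v = (\<Sum>i\<in>I. poly_apply f (q i) v)"
  by (induction I rule: finite_induct) (simp_all add: poly_apply_add)

lemma linear_linear_factors: "Vector_Spaces.linear (*s) (*s) (linear_factors f \<mu>s)"
proof (induction \<mu>s)
  case Nil
  show ?case by unfold_locales simp_all
next
  case (Cons \<mu> \<mu>s)
  have "Vector_Spaces.linear (*s) (*s) (\<lambda>v. f v - \<mu> *s v)"
    by unfold_locales (simp_all add: f_add f_scale vec_eq_iff algebra_simps)
  from Vector_Spaces.linear_compose[OF this Cons] show ?case
    by (simp add: linear_factors_def o_def)
qed

lemma linear_factors_factor:
  "linear_factors f \<mu>s (f v - \<mu> *s v) = f (linear_factors f \<mu>s v) - \<mu> *s linear_factors f \<mu>s v"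
  by (rule linear_factors_commute)
    (simp add: f_diff f_scale vec_eq_iff algebra_simps)

lemma linear_factors_swap:
  "linear_factors f \<mu>s (linear_factors f \<nu>s v) = linear_factors f \<nu>s (linear_factors f \<mu>s v)"
  by (induction \<nu>s arbitrary: v) (simp_all add: linear_factors_factor)

lemma linear_factors_append:
  "linear_factors f (\<mu>s @ \<nu>s) v = linear_factors f \<nu>s (linear_factors f \<mu>s v)"
  by (simp add: linear_factors_def)

text \<open>Induction on the degree: the fundamental theorem of algebra supplies a root, which
  becomes the head of the list.\<close>

lemma poly_apply_factorization:
  assumes "q \<noteq> 0"
  shows "\<exists>\<mu>s. length \<mu>s = degree q \<and> (\<forall>v. poly_apply f q v = lead_coeff q *s linear_factors f \<mu>s v)"
  using assms
proof (induction "degree q" arbitrary: q)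
  case 0
  then obtain a where "q = [:a:]" by (metis degree_eq_zeroE)
  then show ?case by (intro exI[of _ "[]"]) (simp add: f_0)
next
  case (Suc m)
  then have "\<not> constant (poly q)" by (simp add: constant_degree)
  then obtain \<mu> where "poly q \<mu> = 0" using fundamental_theorem_of_algebra by blast
  then obtain s where s: "q = [:- \<mu>, 1:] * s" by (auto simp: poly_eq_0_iff_dvd dvd_def)
  have "s \<noteq> 0" using s Suc.prems by auto
  then have deg: "degree q = Suc (degree s)" and lead: "lead_coeff q = lead_coeff s"
    unfolding s lead_coeff_mult using \<open>s \<noteq> 0\<close>
    by (simp_all add: degree_mult_eq del: mult_pCons_left)
  obtain \<mu>s where \<mu>s: "length \<mu>s = degree s"
    "\<And>v. poly_apply f s v = lead_coeff s *s linear_factors f \<mu>s v"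
    using Suc.hyps deg \<open>s \<noteq> 0\<close> by (metis nat.inject)
  have q: "q = smult (- \<mu>) s + pCons 0 s" unfolding s by simp
  have "poly_apply f q v = f (poly_apply f s v) - \<mu> *s poly_apply f s v" for v
    unfolding q poly_apply_add poly_apply_smult poly_apply_pCons
    by (simp add: vec.scale_minus_left)
  then have "poly_apply f q v = lead_coeff q *s linear_factors f (\<mu> # \<mu>s) v" for v
    by (simp add: \<mu>s lead f_scale linear_factors_factor vec.scale_right_diff_distrib mult.commute)
  with \<mu>s deg show ?case by (intro exI[of _ "\<mu> # \<mu>s"]) auto
qed

text \<open>Linear dependence of more vectors than the dimension, for an indexed family. Dependence
  of the image set sees only distinct vectors, so a repeated vector is treated apart, with
  coefficients 1 and -1.\<close>

lemma exists_vanishing_combination: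
  fixes y :: "nat \<Rightarrow> complex^'n"
  shows "\<exists>u. (\<exists>i\<le>CARD('n). u i \<noteq> 0) \<and> (\<Sum>i\<le>CARD('n). u i *s y i) = 0"
proof (cases "inj_on y {..CARD('n)}")
  case True
  have "card (y ` {..CARD('n)}) > vec.dim (y ` {..CARD('n)})"
    using card_image[OF True] dim_subset_UNIV_cart_gen[of "y ` {..CARD('n)}"] by simp
  then have "vec.dependent (y ` {..CARD('n)})" by (rule vec.dependent_biggerset_general)
  then obtain c where "\<exists>v\<in>y ` {..CARD('n)}. c v \<noteq> 0" "(\<Sum>v\<in>y ` {..CARD('n)}. c v *s v) = 0"
    by (auto simp: vec.dependent_finite)
  then show ?thesis
    by (intro exI[of _ "c \<circ> y"]) (auto simp: sum.reindex[OF True])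
next
  case False
  then obtain i j where ij: "i \<le> CARD('n)" "j \<le> CARD('n)" "i \<noteq> j" "y i = y j"
    by (auto simp: inj_on_def)
  define u where "u k = (if k = i then 1 else if k = j then - 1 else 0 :: complex)" for k
  have "(\<Sum>k\<le>CARD('n). u k *s y k) = (\<Sum>k\<in>{i, j}. u k *s y k)"
    using ij by (intro sum.mono_neutral_right) (auto simp: u_def)
  also have "\<dots> = 0" using ij by (simp add: u_def vec.scale_minus_left)
  finally show ?thesis using ij by (intro exI[of _ u]) (auto simp: u_def)
qed

text \<open>A local substitute for Cayley-Hamilton: the iterates of \<open>x\<close> up to exponent
  \<open>CARD('n)\<close> are dependent, and the resulting polynomial splits into linear factors. A
  factor whose root is not an eigenvalue is injective and can be cancelled.\<close>

lemma exists_annihilating_eigenvalues: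
  obtains \<mu>s where "length \<mu>s \<le> CARD('n)" "linear_factors f \<mu>s x = 0"
    "\<And>\<mu>. \<mu> \<in> set \<mu>s \<Longrightarrow> \<exists>v. v \<noteq> 0 \<and> f v = \<mu> *s v"
proof -
  obtain u where u: "\<exists>i\<le>CARD('n). u i \<noteq> 0" "(\<Sum>i\<le>CARD('n). u i *s (f ^^ i) x) = 0"
    using exists_vanishing_combination[of "\<lambda>i. (f ^^ i) x"] by auto
  define q where "q = (\<Sum>i\<le>CARD('n). monom (u i) i)"
  have "coeff q i = u i" if "i \<le> CARD('n)" for i
    using that by (simp add: q_def coeff_sum)
  with u(1) have "q \<noteq> 0" by force
  then obtain \<mu>s where \<mu>s: "length \<mu>s = degree q"
    "\<And>v. poly_apply f q v = lead_coeff q *s linear_factors f \<mu>s v"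
    using poly_apply_factorization by blast
  have "degree q \<le> CARD('n)"
    unfolding q_def by (intro degree_sum_le) (auto intro: order_trans[OF degree_monom_le])
  moreover have "poly_apply f q x = 0"
    using u(2) by (simp add: q_def poly_apply_sum poly_apply_monom)
  then have ann: "linear_factors f \<mu>s x = 0"
    using \<mu>s(2)[of x] \<open>q \<noteq> 0\<close> by (simp add: vec.scale_eq_0_iff)
  define E where "E \<mu> \<longleftrightarrow> (\<exists>v. v \<noteq> 0 \<and> f v = \<mu> *s v)" for \<mu>
  have "linear_factors f (filter E \<mu>s) x = 0"
    using ann
  proof (induction \<mu>s arbitrary: x)
    case (Cons \<mu> \<mu>s)
    then have "linear_factors f (filter E \<mu>s) (f x - \<mu> *s x) = 0" by simp
    moreover from this have "linear_factors f (filter E \<mu>s) x = 0" if "\<not> E \<mu>"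
      using that unfolding linear_factors_factor E_def by auto
    ultimately show ?case by auto
  qed simp
  moreover have "length (filter E \<mu>s) \<le> CARD('n)"
    using \<open>degree q \<le> CARD('n)\<close> length_filter_le[of E \<mu>s] \<mu>s(1) by linarith
  ultimately show ?thesis by (intro that[of "filter E \<mu>s"]) (simp_all add: E_def)
qed

lemma linear_factors_eigenvector:
  assumes "f v = l *s v"
  shows "linear_factors f \<mu>s v = (\<Prod>\<mu>\<leftarrow>\<mu>s. l - \<mu>) *s v"
proof (induction \<mu>s)
  case (Cons \<mu> \<mu>s)
  have "linear_factors f (\<mu> # \<mu>s) v = f (linear_factors f \<mu>s v) - \<mu> *s linear_factors f \<mu>s v"
    by (simp add: linear_factors_factor)
  then show ?case
    by (simp add: Cons f_scale assms vec_eq_iff algebra_simps)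
qed simp

text \<open>Concatenating annihilating lists of the basis vectors gives one product of factors that
  vanishes everywhere. On an eigenvector it acts as a scalar, so each eigenvalue occurs in the
  list.\<close>

lemma finite_eigenvalues_linear: "finite {l. \<exists>v. v \<noteq> 0 \<and> f v = l *s v}"
proof -
  have "\<exists>\<mu>s. \<forall>b\<in>B. linear_factors f \<mu>s b = 0" if "finite B" for B
    using that
  proof (induction B rule: finite_induct)
    case (insert b B)
    then obtain \<mu>s where \<mu>s: "\<forall>b\<in>B. linear_factors f \<mu>s b = 0" by auto
    obtain \<nu>s where "linear_factors f \<nu>s b = 0" using exists_annihilating_eigenvalues[of b] .
    then have "linear_factors f (\<mu>s @ \<nu>s) b = 0"
      using vec.linear_0[OF linear_linear_factors]
      by (simp add: linear_factors_append linear_factors_swap[of \<nu>s \<mu>s])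
    moreover have "linear_factors f (\<mu>s @ \<nu>s) c = 0" if "c \<in> B" for c
      using \<mu>s that vec.linear_0[OF linear_linear_factors] by (simp add: linear_factors_append)
    ultimately have "\<forall>c\<in>insert b B. linear_factors f (\<mu>s @ \<nu>s) c = 0" by blast
    then show ?case by blast
  qed simp
  then obtain \<mu>s where \<mu>s: "\<forall>b\<in>cart_basis. linear_factors f \<mu>s b = 0"
    using finite_cart_basis by blast
  have "linear_factors f \<mu>s v = 0" for v
    by (rule vec.linear_eq_0_on_span[OF linear_linear_factors, of cart_basis]) (use \<mu>s in auto)
  then have "(\<Prod>\<mu>\<leftarrow>\<mu>s. l - \<mu>) = 0" if "v \<noteq> 0" "f v = l *s v" for l v
    using linear_factors_eigenvector[OF that(2), of \<mu>s] that(1) by (simp add: vec.scale_eq_0_iff)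
  then have "{l. \<exists>v. v \<noteq> 0 \<and> f v = l *s v} \<subseteq> set \<mu>s"
    by (force simp: prod_list_zero_iff)
  then show ?thesis by (rule finite_subset) simp
qed

end

lemma finite_eigenvalues: "finite (eigenvalues A)"
  unfolding eigenvalues_def by (rule finite_eigenvalues_linear) simp

text \<open>The empty list cannot annihilate the nonzero vector 1. Together with finiteness this
  makes the \<open>Max\<close> in \<open>max_eigenvalue_modulus\<close> meaningful.\<close>

lemma eigenvalues_nonempty: "eigenvalues A \<noteq> {}"
proof (rule exists_annihilating_eigenvalues[OF matrix_vector_mul_linear_gen, of A 1])
  fix \<mu>s
  assume \<mu>s: "linear_factors ((*v) A) \<mu>s 1 = 0"
    "\<And>\<mu>. \<mu> \<in> set \<mu>s \<Longrightarrow> \<exists>v. v \<noteq> 0 \<and> A *v v = \<mu> *s v"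
  from \<mu>s(1) have "\<mu>s \<noteq> []" by auto
  then show ?thesis
    using \<mu>s(2)[of "hd \<mu>s"] by (auto simp: eigenvalues_def)
qed

section \<open>Product sets and the joint spectral radius\<close>

lemma op_norm_nonneg: "0 \<le> op_norm A"
  unfolding op_norm_def by (intro onorm_pos_le matrix_vector_mul_bounded_linear)

lemma norm_matrix_vector_le: "norm (A *v v) \<le> op_norm A * norm v" for A :: "complex^'n^'n"
  unfolding op_norm_def by (intro onorm matrix_vector_mul_bounded_linear)

lemma op_norm_le: "0 \<le> b \<Longrightarrow> (\<And>v. norm (A *v v) \<le> b * norm v) \<Longrightarrow> op_norm A \<le> b"
  unfolding op_norm_def by (rule onorm_bound)

lemma op_norm_mult_le: "op_norm (A ** B) \<le> op_norm A * op_norm B" for A :: "complex^'n^'n"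
proof (rule op_norm_le)
  fix v
  have "norm ((A ** B) *v v) \<le> op_norm A * norm (B *v v)"
    by (simp add: norm_matrix_vector_le flip: matrix_vector_mul_assoc)
  also have "\<dots> \<le> op_norm A * (op_norm B * norm v)"
    by (intro mult_left_mono norm_matrix_vector_le op_norm_nonneg)
  finally show "norm ((A ** B) *v v) \<le> op_norm A * op_norm B * norm v" by (simp add: mult.assoc)
qed (simp add: op_norm_nonneg)

lemma op_norm_mat_1_le: "op_norm (mat 1) \<le> 1"
  by (rule op_norm_le) simp_all

text \<open>Boundedness of \<open>S\<close> refers to the norm of the matrix type, not to the
  operator norm; bilinearity of the matrix-vector product compares them.\<close>

lemma op_norm_bounded:
  fixes S :: "(complex^'n^'n) set"
  assumes "bounded S"
  obtains M where "0 \<le> M" "\<And>s. s \<in> S \<Longrightarrow> op_norm s \<le> M"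
proof -
  have "bilinear ((*v) :: complex^'n^'n \<Rightarrow> complex^'n \<Rightarrow> complex^'n)"
    unfolding bilinear_def
    by (auto simp: linear_iff matrix_vector_mult_add_rdistrib matrix_vector_mult_def vec_eq_iff
        sum.distrib scaleR_sum_right algebra_simps)
  from bilinear_bounded_pos[OF this] obtain B where B: "B > 0"
    "\<And>(A :: complex^'n^'n) v. norm (A *v v) \<le> B * norm A * norm v" by auto
  obtain b where b: "\<And>s. s \<in> S \<Longrightarrow> norm s \<le> b" using assms by (auto simp: bounded_iff)
  show ?thesis
  proof (rule that[of "B * \<bar>b\<bar>"])
    fix s assume "s \<in> S"
    have "op_norm s \<le> B * norm s" by (rule op_norm_le) (use B in auto)
    also have "\<dots> \<le> B * \<bar>b\<bar>" using b[OF \<open>s \<in> S\<close>] B by (intro mult_left_mono) auto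
    finally show "op_norm s \<le> B * \<bar>b\<bar>" .
  qed (use B in auto)
qed

section \<open>Product sets and the norms of their elements\<close>

lemma prod_set_0: "prod_set S 0 = {mat 1}"
  by (simp add: prod_set_def)

lemma prod_set_Suc: "prod_set S (Suc k) = {s ** w |s w. s \<in> S \<and> w \<in> prod_set S k}"
proof (intro set_eqI iffI)
  fix x assume "x \<in> prod_set S (Suc k)"
  then obtain ss where "x = foldr (**) ss (mat 1)" "length ss = Suc k" "set ss \<subseteq> S"
    by (auto simp: prod_set_def)
  then show "x \<in> {s ** w |s w. s \<in> S \<and> w \<in> prod_set S k}"
    by (cases ss) (auto simp: prod_set_def)
next
  fix x assume "x \<in> {s ** w |s w. s \<in> S \<and> w \<in> prod_set S k}"
  then obtain s ss where "x = s ** foldr (**) ss (mat 1)" "s \<in> S" "length ss = k" "set ss \<subseteq> S"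
    by (auto simp: prod_set_def)
  then show "x \<in> prod_set S (Suc k)"
    by (auto simp: prod_set_def intro!: exI[of _ "s # ss"])
qed

lemma prod_set_add: "prod_set S (k + m) = {u ** w |u w. u \<in> prod_set S k \<and> w \<in> prod_set S m}"
proof (induction k)
  case 0
  show ?case by (auto simp: prod_set_0)
next
  case (Suc k)
  have "x \<in> prod_set S (Suc k + m) \<longleftrightarrow>
      (\<exists>s u w. s \<in> S \<and> u \<in> prod_set S k \<and> w \<in> prod_set S m \<and> x = s ** u ** w)" for x
    unfolding add_Suc prod_set_Suc Suc.IH mem_Collect_eq by (metis matrix_mul_assoc)
  then show ?case unfolding prod_set_Suc[of S k] by blast
qed

lemma nonneg_Sup_le: "0 \<le> b \<Longrightarrow> (\<And>x. x \<in> X \<Longrightarrow> x \<le> b) \<Longrightarrow> nonneg_Sup X \<le> b"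
  unfolding nonneg_Sup_def by (rule cSup_least) auto

lemma le_nonneg_Sup: "bdd_above X \<Longrightarrow> x \<in> X \<Longrightarrow> x \<le> nonneg_Sup X"
  unfolding nonneg_Sup_def by (rule cSup_upper) auto

lemma nonneg_Sup_nonneg: "bdd_above X \<Longrightarrow> 0 \<le> nonneg_Sup X"
  unfolding nonneg_Sup_def by (rule cSup_upper) auto

lemma bdd_above_op_norm_prod_set:
  assumes "bounded S"
  shows "bdd_above (op_norm ` prod_set S k)"
proof -
  obtain M where M: "0 \<le> M" "\<And>s. s \<in> S \<Longrightarrow> op_norm s \<le> M"
    using op_norm_bounded[OF assms] by blast
  have "op_norm w \<le> M ^ k" if "w \<in> prod_set S k" for w
    using that
  proof (induction k arbitrary: w)
    case 0
    then show ?case by (simp add: prod_set_0 op_norm_mat_1_le)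
  next
    case (Suc k)
    then obtain s u where su: "w = s ** u" "s \<in> S" "u \<in> prod_set S k" by (auto simp: prod_set_Suc)
    have "op_norm w \<le> op_norm s * op_norm u" unfolding su by (rule op_norm_mult_le)
    also have "\<dots> \<le> M * M ^ k" using M Suc.IH su op_norm_nonneg by (intro mult_mono) auto
    finally show ?case by simp
  qed
  then show ?thesis by (intro bdd_aboveI[of _ "M ^ k"]) auto
qed

lemma op_norm_le_set_norm:
  "bounded S \<Longrightarrow> w \<in> prod_set S k \<Longrightarrow> op_norm w \<le> set_norm (prod_set S k)"
  unfolding set_norm_def by (rule le_nonneg_Sup[OF bdd_above_op_norm_prod_set]) auto

lemma set_norm_nonneg: "bounded S \<Longrightarrow> 0 \<le> set_norm (prod_set S k)"
  unfolding set_norm_def by (rule nonneg_Sup_nonneg[OF bdd_above_op_norm_prod_set])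

lemma set_norm_le: "0 \<le> b \<Longrightarrow> (\<And>w. w \<in> X \<Longrightarrow> op_norm w \<le> b) \<Longrightarrow> set_norm X \<le> b"
  unfolding set_norm_def by (rule nonneg_Sup_le) auto

lemma set_norm_prod_set_add_le:
  assumes "bounded S"
  shows "set_norm (prod_set S (k + m)) \<le> set_norm (prod_set S k) * set_norm (prod_set S m)"
proof (rule set_norm_le)
  fix w assume "w \<in> prod_set S (k + m)"
  then obtain u v where uv: "w = u ** v" "u \<in> prod_set S k" "v \<in> prod_set S m"
    by (auto simp: prod_set_add)
  have "op_norm w \<le> op_norm u * op_norm v" unfolding uv by (rule op_norm_mult_le)
  also have "\<dots> \<le> set_norm (prod_set S k) * set_norm (prod_set S m)"
    using uv assms by (intro mult_mono op_norm_le_set_norm op_norm_nonneg set_norm_nonneg)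
  finally show "op_norm w \<le> set_norm (prod_set S k) * set_norm (prod_set S m)" .
qed (simp add: set_norm_nonneg assms)

text \<open>Division with remainder by \<open>m\<close>: full blocks contribute powers of
  \<open>c\<close>, and \<open>K\<close> absorbs the finitely many remainders.\<close>

lemma submultiplicative_le_power:
  fixes a :: "nat \<Rightarrow> real"
  assumes nonneg: "\<And>n. 0 \<le> a n" and submult: "\<And>m n. a (m + n) \<le> a m * a n"
    and m: "m > 0" and c: "c > 0" "a m \<le> c ^ m"
  obtains K where "K > 0" "\<And>n. a n \<le> K * c ^ n"
proof -
  define K where "K = 1 + (\<Sum>s<m. a s / c ^ s)"
  have le: "a (m * q + s) \<le> c ^ (m * q) * a s" for q s
  proof (induction q)
    case (Suc q)
    have "a (m * Suc q + s) \<le> a m * a (m * q + s)"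
      using submult[of m "m * q + s"] by (simp add: ac_simps)
    also have "\<dots> \<le> c ^ m * (c ^ (m * q) * a s)"
      using Suc c nonneg by (intro mult_mono) auto
    finally show ?case by (simp add: power_add mult.assoc)
  qed simp
  show ?thesis
  proof (rule that)
    show "K > 0" unfolding K_def using nonneg c by (intro add_pos_nonneg sum_nonneg) auto
    fix n
    define q s where "q = n div m" and "s = n mod m"
    have n: "n = m * q + s" "s < m" using m by (simp_all add: q_def s_def)
    have "a s / c ^ s \<le> (\<Sum>s<m. a s / c ^ s)"
      using n nonneg c by (intro member_le_sum) auto
    then have "a s / c ^ s \<le> K" by (simp add: K_def)
    then have "a s \<le> K * c ^ s" using c by (simp add: pos_divide_le_eq)
    then have "c ^ (m * q) * a s \<le> c ^ (m * q) * (K * c ^ s)" using c by (intro mult_left_mono) auto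
    with le[of q s] show "a n \<le> K * c ^ n" unfolding n by (simp add: power_add ac_simps)
  qed
qed

text \<open>Fekete's lemma. It shows that the \<open>lim\<close> in
  \<open>joint_spectral_radius\<close> exists; the infimum gives a lower bound at every length, the
  convergence an upper bound on growth.\<close>

lemma submultiplicative_root_tendsto:
  fixes a :: "nat \<Rightarrow> real"
  assumes nonneg: "\<And>n. 0 \<le> a n" and submult: "\<And>m n. a (m + n) \<le> a m * a n"
  shows "(\<lambda>n. root n (a n)) \<longlonglongrightarrow> (INF n\<in>{0<..}. root n (a n))"
proof -
  let ?L = "INF n\<in>{0<..}. root n (a n)"
  have bdd: "bdd_below ((\<lambda>n. root n (a n)) ` {0<..})"
    using nonneg by (intro bdd_belowI[of _ 0]) auto
  have lower: "\<forall>\<^sub>F n in sequentially. b < root n (a n)" if "b < ?L" for b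
  proof -
    have "b < root n (a n)" if "n > 0" for n
      using cINF_lower[OF bdd, of n] that \<open>b < ?L\<close> by simp
    then show ?thesis by (intro eventually_sequentiallyI[of 1]) auto
  qed
  have upper: "\<forall>\<^sub>F n in sequentially. root n (a n) < b" if "?L < b" for b
  proof -
    have "(?L < b) = (\<exists>n\<in>{0<..}. root n (a n) < b)"
      by (rule cINF_less_iff[OF _ bdd]) auto
    with that obtain m where m: "m > 0" "root m (a m) < b" by auto
    then obtain c where c: "root m (a m) < c" "c < b" using dense by blast
    have "0 \<le> root m (a m)" using nonneg by (simp add: real_root_ge_zero)
    then have "c > 0" using c by linarith
    have "a m = root m (a m) ^ m" using m nonneg by simp
    also have "\<dots> \<le> c ^ m" using c \<open>0 \<le> root m (a m)\<close> by (intro power_mono) auto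
    finally obtain K where K: "K > 0" "\<And>n. a n \<le> K * c ^ n"
      using submultiplicative_le_power[OF nonneg submult m(1) \<open>c > 0\<close>] by blast
    have "(\<lambda>n. root n K * c) \<longlonglongrightarrow> 1 * c"
      using K(1) by (intro tendsto_mult LIMSEQ_root_const tendsto_const)
    then have "\<forall>\<^sub>F n in sequentially. root n K * c < b"
      using c by (intro order_tendstoD(2)) auto
    then show ?thesis
      using eventually_gt_at_top[of 0]
    proof eventually_elim
      case (elim n)
      have "root n (a n) \<le> root n (K * c ^ n)" using elim K(2) by simp
      also have "\<dots> = root n K * c"
        using elim \<open>c > 0\<close> by (simp add: real_root_mult real_root_power_cancel)
      finally show ?case using elim by simp
    qed
  qed
  show ?thesis using lower upper by (rule order_tendstoI)
qed

lemma set_norm_prod_set_ge_1: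
  assumes "bounded S" "joint_spectral_radius S = 1" "k > 0"
  shows "1 \<le> set_norm (prod_set S k)"
proof -
  let ?a = "\<lambda>n. set_norm (prod_set S n)"
  note tendsto = submultiplicative_root_tendsto[of ?a, OF set_norm_nonneg[OF assms(1)]
      set_norm_prod_set_add_le[OF assms(1)]]
  have "1 = (INF n\<in>{0<..}. root n (?a n))"
    using limI[OF tendsto] assms(2) by (simp add: joint_spectral_radius_def)
  also have "\<dots> \<le> root k (?a k)"
    using assms(3) set_norm_nonneg[OF assms(1)] by (intro cINF_lower bdd_belowI[of _ 0]) auto
  finally show ?thesis using assms(3) by (simp add: real_root_ge_1_iff)
qed

lemma set_norm_prod_set_le:
  assumes "bounded S" "joint_spectral_radius S = 1" "c > 1"
  obtains K where "K > 0" "\<And>k. set_norm (prod_set S k) \<le> K * c ^ k"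
proof -
  let ?a = "\<lambda>n. set_norm (prod_set S n)"
  note submult = set_norm_nonneg[OF assms(1)] set_norm_prod_set_add_le[OF assms(1)]
  note tendsto = submultiplicative_root_tendsto[of ?a, OF submult]
  have "(\<lambda>n. root n (?a n)) \<longlonglongrightarrow> 1"
    using tendsto limI[OF tendsto] assms(2) by (simp add: joint_spectral_radius_def)
  then have "\<forall>\<^sub>F n in sequentially. root n (?a n) < c" using assms(3) by (rule order_tendstoD(2))
  then have "\<forall>\<^sub>F n in sequentially. root n (?a n) < c \<and> n > 0"
    using eventually_gt_at_top[of 0] by (rule eventually_conj)
  then obtain m where m: "root m (?a m) < c" "m > 0" by (auto simp: eventually_sequentially)
  have "?a m = root m (?a m) ^ m" using m submult by simp
  also have "\<dots> \<le> c ^ m" using m submult by (intro power_mono) auto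
  finally show ?thesis
    using submultiplicative_le_power[of ?a, OF submult m(2), of c] assms(3) that by auto
qed

section \<open>Almost extremal norms and orbits\<close>

text \<open>The damping \<open>t ^ k\<close> keeps the supremum finite even if the products of
  \<open>S\<close> are not uniformly bounded.\<close>

definition semigroup_norm :: "(complex^'n^'n) set \<Rightarrow> real \<Rightarrow> complex^'n \<Rightarrow> real" where
  "semigroup_norm S t v = Sup {t ^ k * norm (w *v v) |k w. w \<in> prod_set S k}"

lemma norm_vector_smult: "norm (c *s x) = cmod c * norm x" for x :: "complex^'n"
  by (simp add: norm_vec_def norm_mult L2_set_right_distrib)

context
  fixes S :: "(complex^'n^'n) set" and t K :: real
  assumes bounded: "bounded S" and t: "0 < t"
    and growth: "\<And>k. set_norm (prod_set S k) \<le> K * (1 / t) ^ k"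
begin

lemma semigroup_norm_upper:
  assumes "w \<in> prod_set S k"
  shows "t ^ k * norm (w *v v) \<le> K * norm v"
proof -
  have "norm (w *v v) \<le> op_norm w * norm v" by (rule norm_matrix_vector_le)
  also have "\<dots> \<le> K * (1 / t) ^ k * norm v"
    using op_norm_le_set_norm[OF bounded assms] growth[of k] by (intro mult_right_mono) auto
  finally show ?thesis using t by (simp add: power_one_over divide_simps mult.commute mult.left_commute)
qed

lemma le_semigroup_norm:
  "w \<in> prod_set S k \<Longrightarrow> t ^ k * norm (w *v v) \<le> semigroup_norm S t v"
  unfolding semigroup_norm_def
  by (rule cSup_upper) (auto intro!: bdd_aboveI[of _ "K * norm v"] semigroup_norm_upper)

lemma semigroup_norm_le:
  assumes "\<And>k w. w \<in> prod_set S k \<Longrightarrow> t ^ k * norm (w *v v) \<le> b"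
  shows "semigroup_norm S t v \<le> b"
  unfolding semigroup_norm_def
proof (rule cSup_least)
  show "{t ^ k * norm (w *v v) |k w. w \<in> prod_set S k} \<noteq> {}"
    using prod_set_0[of S] by blast
qed (use assms in auto)

lemma semigroup_norm_contraction:
  assumes "w \<in> prod_set S k"
  shows "t ^ k * semigroup_norm S t (w *v v) \<le> semigroup_norm S t v"
proof -
  have "semigroup_norm S t (w *v v) \<le> semigroup_norm S t v / t ^ k"
  proof (rule semigroup_norm_le)
    fix m u assume "u \<in> prod_set S m"
    then have "u ** w \<in> prod_set S (m + k)" using assms by (auto simp: prod_set_add)
    from le_semigroup_norm[OF this, of v]
    show "t ^ m * norm (u *v (w *v v)) \<le> semigroup_norm S t v / t ^ k"
      using t by (simp add: matrix_vector_mul_assoc power_add pos_le_divide_eq ac_simps)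
  qed
  then show ?thesis using t by (simp add: pos_le_divide_eq mult.commute)
qed

lemma semigroup_norm_scale_le: "semigroup_norm S t (c *s v) \<le> cmod c * semigroup_norm S t v"
proof (rule semigroup_norm_le)
  fix k w assume "w \<in> prod_set S k"
  then have "cmod c * (t ^ k * norm (w *v v)) \<le> cmod c * semigroup_norm S t v"
    by (intro mult_left_mono le_semigroup_norm) auto
  then show "t ^ k * norm (w *v (c *s v)) \<le> cmod c * semigroup_norm S t v"
    by (simp add: vec.linear_scale[OF matrix_vector_mul_linear_gen] norm_vector_smult mult.left_commute)
qed

lemma equivalent_norm_semigroup_norm: "equivalent_norm (semigroup_norm S t) K"
proof
  fix x y :: "complex^'n" and c :: complex
  show "semigroup_norm S t (x + y) \<le> semigroup_norm S t x + semigroup_norm S t y"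
  proof (rule semigroup_norm_le)
    fix k w assume w: "w \<in> prod_set S k"
    have "t ^ k * norm (w *v (x + y)) \<le> t ^ k * (norm (w *v x) + norm (w *v y))"
      unfolding matrix_vector_right_distrib using t by (intro mult_left_mono norm_triangle_ineq) auto
    also have "\<dots> \<le> semigroup_norm S t x + semigroup_norm S t y"
      using le_semigroup_norm[OF w] by (simp add: distrib_left add_mono)
    finally show "t ^ k * norm (w *v (x + y)) \<le> semigroup_norm S t x + semigroup_norm S t y" .
  qed
  show lower: "norm x \<le> semigroup_norm S t x" for x
    using le_semigroup_norm[of "mat 1" 0 x] by (simp add: prod_set_0)
  show "semigroup_norm S t x \<le> K * norm x"
    by (rule semigroup_norm_le) (rule semigroup_norm_upper)
  show "semigroup_norm S t (c *s x) = cmod c * semigroup_norm S t x"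
  proof (cases "c = 0")
    case True
    then show ?thesis using semigroup_norm_scale_le[of c x] lower[of "c *s x"] by simp
  next
    case False
    \<comment> \<open>The reverse inequality is the scaling inequality for
      \<open>inverse c\<close>.\<close>
    have "cmod c * semigroup_norm S t x = cmod c * semigroup_norm S t (inverse c *s (c *s x))"
      using False by simp
    also have "\<dots> \<le> cmod c * (cmod (inverse c) * semigroup_norm S t (c *s x))"
      by (intro mult_left_mono semigroup_norm_scale_le) auto
    also have "\<dots> = semigroup_norm S t (c *s x)" using False by (simp add: norm_inverse)
    finally show ?thesis using semigroup_norm_scale_le[of c x] by simp
  qed
qed

end

text \<open>If all products of length \<open>n\<close> contracted \<open>p\<close> by
  \<open>c\<close>, those of length \<open>n * q\<close> would have operator norm at most
  \<open>c ^ q * K\<close>, which tends to 0, whereas their supremum is at least 1.\<close>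

lemma (in equivalent_norm) exists_expanding_product:
  fixes S :: "(complex^'n^'n) set"
  assumes S: "bounded S" "joint_spectral_radius S = 1" and n: "n > 0" and c: "0 \<le> c" "c < 1"
  obtains w v where "w \<in> prod_set S n" "p (w *v v) > c * p v"
proof (rule ccontr)
  assume "\<not> thesis"
  with that have contr: "p (w *v v) \<le> c * p v" if "w \<in> prod_set S n" for w v
    using \<open>w \<in> prod_set S n\<close> by (meson not_le)
  have pow: "p (w *v v) \<le> c ^ q * p v" if "w \<in> prod_set S (n * q)" for w v q
    using that
  proof (induction q arbitrary: w)
    case 0
    then show ?case by (simp add: prod_set_0)
  next
    case (Suc q)
    then obtain u w' where u: "w = u ** w'" "u \<in> prod_set S n" "w' \<in> prod_set S (n * q)"
      by (auto simp: prod_set_add)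
    have "p (w *v v) \<le> c * p (w' *v v)"
      using contr[OF u(2)] by (simp add: u(1) flip: matrix_vector_mul_assoc)
    also have "\<dots> \<le> c * (c ^ q * p v)" using c Suc.IH[OF u(3)] by (intro mult_left_mono)
    finally show ?case by simp
  qed
  have "0 < norm (1 :: complex^'n)" by simp
  moreover have "norm (1 :: complex^'n) \<le> K * norm (1 :: complex^'n)"
    using norm_le le_norm order_trans by blast
  ultimately have "K \<ge> 0" by (metis less_le_trans less_eq_real_def zero_less_mult_pos2)
  have ge_1: "1 \<le> c ^ q * K" if "q > 0" for q
  proof -
    have "set_norm (prod_set S (n * q)) \<le> c ^ q * K"
    proof (intro set_norm_le op_norm_le)
      fix w v assume "w \<in> prod_set S (n * q)"
      then have "norm (w *v v) \<le> c ^ q * p v" using pow norm_le order_trans by blast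
      also have "\<dots> \<le> c ^ q * (K * norm v)" using c by (intro mult_left_mono le_norm) auto
      finally show "norm (w *v v) \<le> c ^ q * K * norm v" by (simp add: mult.assoc)
    qed (use c \<open>K \<ge> 0\<close> in auto)
    with set_norm_prod_set_ge_1[OF S, of "n * q"] n that show ?thesis by simp
  qed
  have "(\<lambda>q. c ^ q * K) \<longlonglongrightarrow> 0 * K"
    using c by (intro tendsto_mult LIMSEQ_power_zero tendsto_const) auto
  then have "\<forall>\<^sub>F q in sequentially. c ^ q * K < 1" by (rule order_tendstoD(2)) simp
  then have "\<forall>\<^sub>F q in sequentially. c ^ q * K < 1 \<and> q > 0"
    using eventually_gt_at_top[of 0] by (rule eventually_conj)
  then obtain q where "c ^ q * K < 1" "q > 0" by (auto simp: eventually_sequentially)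
  with ge_1[of q] show False by simp
qed

text \<open>The letters of \<open>w\<close> act from right to left, so a new leftmost letter extends
  the orbit at its end. The connecting product is recorded for every pair of times, since returns
  between arbitrary times are studied later.\<close>

lemma exists_orbit:
  fixes S :: "(complex^'n^'n) set"
  assumes "w \<in> prod_set S n"
  shows "\<exists>x. x 0 = v \<and> x n = complex_of_real (t ^ n) *s (w *v v) \<and>
    (\<forall>i j. i \<le> j \<longrightarrow> j \<le> n \<longrightarrow>
      (\<exists>u\<in>prod_set S (j - i). x j = complex_of_real (t ^ (j - i)) *s (u *v x i)))"
  using assms
proof (induction n arbitrary: w)
  case 0
  then show ?case by (intro exI[of _ "\<lambda>_. v"]) (auto simp: prod_set_0)
next
  case (Suc n)
  then obtain s u where su: "w = s ** u" "s \<in> S" "u \<in> prod_set S n" by (auto simp: prod_set_Suc)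
  obtain x where x: "x 0 = v" "x n = complex_of_real (t ^ n) *s (u *v v)"
    "\<And>i j. i \<le> j \<Longrightarrow> j \<le> n \<Longrightarrow>
      \<exists>u\<in>prod_set S (j - i). x j = complex_of_real (t ^ (j - i)) *s (u *v x i)"
    using Suc.IH[OF su(3)] by blast
  note mv_scale = vec.linear_scale[OF matrix_vector_mul_linear_gen]
  define y where "y = x(Suc n := complex_of_real t *s (s *v x n))"
  show ?case
  proof (intro exI[of _ y] conjI allI impI)
    show "y 0 = v" using x by (simp add: y_def)
    show "y (Suc n) = complex_of_real (t ^ Suc n) *s (w *v v)"
      by (simp add: y_def x su mv_scale matrix_vector_mul_assoc)
    fix i j assume ij: "i \<le> j" "j \<le> Suc n"
    consider "j \<le> n" | "j = Suc n" "i \<le> n" | "i = Suc n" "j = Suc n" using ij by linarith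
    then show "\<exists>u\<in>prod_set S (j - i). y j = complex_of_real (t ^ (j - i)) *s (u *v y i)"
    proof cases
      case 1
      then show ?thesis using x(3)[of i j] ij by (simp add: y_def)
    next
      case 2
      then obtain u where u: "u \<in> prod_set S (n - i)"
        "x n = complex_of_real (t ^ (n - i)) *s (u *v x i)" using x(3)[of i n] by auto
      have "y j = complex_of_real (t ^ (j - i)) *s ((s ** u) *v y i)"
        using 2 by (simp add: y_def u(2) Suc_diff_le mv_scale matrix_vector_mul_assoc)
      moreover have "s ** u \<in> prod_set S (j - i)"
        using 2 u(1) su(2) by (auto simp: Suc_diff_le prod_set_Suc)
      ultimately show ?thesis by blast
    next
      case 3
      then show ?thesis by (auto simp: prod_set_0)
    qed
  qed
qed

lemma exists_almost_extremal_orbit: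
  fixes S :: "(complex^'n^'n) set"
  assumes S: "bounded S" "joint_spectral_radius S = 1" and n: "n > 0" and \<beta>: "0 < \<beta>" "\<beta> < 1"
  obtains p K t x where "equivalent_norm p K" "0 < t" "t \<le> 1"
    "\<And>k w v. w \<in> prod_set S k \<Longrightarrow> t ^ k * p (w *v v) \<le> p v"
    "\<And>i. i \<le> n \<Longrightarrow> \<beta> < p (x i)" "\<And>i. i \<le> n \<Longrightarrow> p (x i) \<le> 1"
    "\<And>i j. i \<le> j \<Longrightarrow> j \<le> n \<Longrightarrow>
      \<exists>w\<in>prod_set S (j - i). x j = complex_of_real (t ^ (j - i)) *s (w *v x i)"
proof -
  \<comment> \<open>With this choice \<open>\<beta> < t ^ n < 1\<close>, so some product of length
    \<open>n\<close> expands by more than \<open>\<beta> / t ^ n\<close> and the damped orbit still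
    ends above \<open>\<beta>\<close>.\<close>
  define t where "t = root n ((1 + \<beta>) / 2)"
  have t: "0 < t" "t < 1" "t ^ n = (1 + \<beta>) / 2"
    using n \<beta> by (simp_all add: t_def real_root_lt_1_iff)
  obtain K where K: "\<And>k. set_norm (prod_set S k) \<le> K * (1 / t) ^ k"
    using set_norm_prod_set_le[OF S, of "1 / t"] t by auto
  define p where "p = semigroup_norm S t"
  have p: "equivalent_norm p K"
    unfolding p_def by (rule equivalent_norm_semigroup_norm[OF S(1) t(1) K])
  have contr: "t ^ k * p (w *v v) \<le> p v" if "w \<in> prod_set S k" for k w v
    unfolding p_def by (rule semigroup_norm_contraction[OF S(1) t(1) K that])
  interpret equivalent_norm p K by (rule p)
  have "0 \<le> \<beta> / t ^ n" "\<beta> / t ^ n < 1" using \<beta> by (simp_all add: t(3))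
  then obtain w v where w: "w \<in> prod_set S n" "p (w *v v) > \<beta> / t ^ n * p v"
    using exists_expanding_product[OF S n] by blast
  have "p v > 0"
  proof -
    have "v \<noteq> 0" using w(2) by auto
    then show ?thesis using eq_0D[of v] nonneg[of v] by (metis less_eq_real_def)
  qed
  define v' where "v' = complex_of_real (1 / p v) *s v"
  have v': "p v' = 1" using \<open>p v > 0\<close> by (simp add: v'_def scale norm_divide)
  obtain x where x: "x 0 = v'" "x n = complex_of_real (t ^ n) *s (w *v v')"
    "\<And>i j. i \<le> j \<Longrightarrow> j \<le> n \<Longrightarrow>
      \<exists>u\<in>prod_set S (j - i). x j = complex_of_real (t ^ (j - i)) *s (u *v x i)"
    using exists_orbit[OF w(1), of v' t] by blast
  \<comment> \<open>Monotonicity along the orbit reduces both bounds to its end points.\<close>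
  have decr: "p (x j) \<le> p (x i)" if "i \<le> j" "j \<le> n" for i j
  proof -
    obtain u where "u \<in> prod_set S (j - i)" "x j = complex_of_real (t ^ (j - i)) *s (u *v x i)"
      using x(3)[OF \<open>i \<le> j\<close> \<open>j \<le> n\<close>] by blast
    then show ?thesis using contr[of u "j - i" "x i"] t(1) by (simp add: scale norm_power)
  qed
  have "\<beta> * p v < t ^ n * p (w *v v)" using w(2) t(1) by (simp add: pos_divide_less_eq mult.commute)
  then have "\<beta> < t ^ n * p (w *v v) / p v" using \<open>p v > 0\<close> by (simp add: pos_less_divide_eq)
  also have "\<dots> = p (x n)"
    using \<open>p v > 0\<close> t(1)
    by (simp add: x(2) v'_def vec.linear_scale[OF matrix_vector_mul_linear_gen] scale norm_divide norm_power)
  finally have "\<beta> < p (x n)" .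
  show ?thesis
  proof (rule that[OF p t(1) _ contr])
    show "\<beta> < p (x i)" if "i \<le> n" for i
      using decr[OF that] \<open>\<beta> < p (x n)\<close> by simp
    show "p (x i) \<le> 1" if "i \<le> n" for i
      using decr[of 0 i] that v' x(1) by simp
  qed (use t x(3) in auto)
qed

section \<open>Return times\<close>

lemma cmod_eigenvalue_le:
  assumes "l \<in> eigenvalues A"
  shows "cmod l \<le> max_eigenvalue_modulus A"
  unfolding max_eigenvalue_modulus_def using assms finite_eigenvalues by (intro Max_ge) auto

lemma max_eigenvalue_modulus_le_op_norm: "max_eigenvalue_modulus A \<le> op_norm A"
proof -
  have "cmod l \<le> op_norm A" if "l \<in> eigenvalues A" for l
  proof -
    obtain v where v: "v \<noteq> 0" "A *v v = l *s v" using \<open>l \<in> eigenvalues A\<close> by (auto simp: eigenvalues_def)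
    have "cmod l * norm v \<le> op_norm A * norm v"
      using norm_matrix_vector_le[of A v] by (simp add: v norm_vector_smult)
    then show ?thesis using v by simp
  qed
  then show ?thesis
    unfolding max_eigenvalue_modulus_def using finite_eigenvalues eigenvalues_nonempty
    by (intro Max.boundedI) auto
qed

text \<open>Needed so that \<open>nonneg_Sup\<close> really dominates the individual spectral
  radii.\<close>

lemma bdd_above_max_eigenvalue_modulus:
  assumes "bounded S"
  shows "bdd_above (max_eigenvalue_modulus ` prod_set S k)"
proof (rule bdd_aboveI2)
  fix w assume "w \<in> prod_set S k"
  then show "max_eigenvalue_modulus w \<le> set_norm (prod_set S k)"
    using max_eigenvalue_modulus_le_op_norm[of w] op_norm_le_set_norm[OF assms, of w k] by simp
qed

context equivalent_norm
begin

context
  fixes w :: "complex^'n^'n" and c :: complex and r :: real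
  assumes c: "c \<noteq> 0" "cmod c \<le> 1"
    and contr: "\<And>v. cmod c * p (w *v v) \<le> p v"
    and r: "0 \<le> r" "r < 1"
    and spectrum: "\<And>l. l \<in> eigenvalues w \<Longrightarrow> cmod l \<le> r"
begin

lemma linear_scaled: "Vector_Spaces.linear (*s) (*s) (\<lambda>v. c *s (w *v v))"
  by unfold_locales
    (simp_all add: matrix_vector_right_distrib vec.scale_right_distrib
      vec.linear_scale[OF matrix_vector_mul_linear_gen] mult.commute)

text \<open>The scalar \<open>c\<close> will combine the damping with a quotient of phases.
  Eigenvalues of the scaled map are \<open>c\<close> times those of \<open>w\<close>, and
  \<open>cmod c \<le> 1\<close> keeps them in the disc of radius \<open>r\<close>.\<close>

lemma exists_small_annihilating_list:
  obtains \<mu>s where "length \<mu>s \<le> CARD('n)" "linear_factors (\<lambda>v. c *s (w *v v)) \<mu>s x = 0"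
    "\<And>\<mu>. \<mu> \<in> set \<mu>s \<Longrightarrow> cmod \<mu> \<le> r"
proof (rule exists_annihilating_eigenvalues[OF linear_scaled, of x])
  fix \<mu>s
  assume \<mu>s: "length \<mu>s \<le> CARD('n)" "linear_factors (\<lambda>v. c *s (w *v v)) \<mu>s x = 0"
    "\<And>\<mu>. \<mu> \<in> set \<mu>s \<Longrightarrow> \<exists>v. v \<noteq> 0 \<and> c *s (w *v v) = \<mu> *s v"
  show ?thesis
  proof (rule that[OF \<mu>s(1,2)])
    fix \<mu> assume "\<mu> \<in> set \<mu>s"
    then obtain v where v: "v \<noteq> 0" "c *s (w *v v) = \<mu> *s v" using \<mu>s(3) by blast
    have "w *v v = inverse c *s (c *s (w *v v))" using c by simp
    also have "\<dots> = (\<mu> / c) *s v" unfolding v(2) by (simp add: divide_inverse mult.commute)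
    finally have "cmod (\<mu> / c) \<le> r" using v(1) by (intro spectrum) (auto simp: eigenvalues_def)
    then have "cmod \<mu> \<le> r * cmod c" using c(1) by (simp add: norm_divide pos_divide_le_eq)
    also have "\<dots> \<le> r" using r c(2) by (simp add: mult_left_le)
    finally show "cmod \<mu> \<le> r" .
  qed
qed

lemma return_distance_ge:
  assumes "CARD('n) \<le> Suc k"
  shows "(1 - r) * p x \<le> resolvent_const r k * p (x - c *s (w *v x))"
proof -
  obtain \<mu>s where "length \<mu>s \<le> CARD('n)" "linear_factors (\<lambda>v. c *s (w *v v)) \<mu>s x = 0"
    "\<And>\<mu>. \<mu> \<in> set \<mu>s \<Longrightarrow> cmod \<mu> \<le> r"
    using exists_small_annihilating_list[of x] by blast
  with assms show ?thesis
    by (intro resolvent_bound[OF linear_scaled _ r, of \<mu>s]) (auto simp: scale contr)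
qed

lemma one_dimensional_contraction:
  assumes "CARD('n) = 1"
  shows "p (c *s (w *v x)) \<le> r * p x"
proof -
  obtain \<mu>s where \<mu>s: "length \<mu>s \<le> 1" "linear_factors (\<lambda>v. c *s (w *v v)) \<mu>s x = 0"
    "\<And>\<mu>. \<mu> \<in> set \<mu>s \<Longrightarrow> cmod \<mu> \<le> r"
    using exists_small_annihilating_list[of x] assms by metis
  show ?thesis
  proof (cases \<mu>s)
    case Nil
    with \<mu>s(2) show ?thesis by simp
  next
    case (Cons \<mu> l)
    with \<mu>s have "c *s (w *v x) = \<mu> *s x" "cmod \<mu> \<le> r" by auto
    then show ?thesis by (simp add: scale mult_right_mono)
  qed
qed

end

end

text \<open>
  Multiplying the points of an orbit by several phases enlarges the set to be packed.  In
  dimension 2 a gain of more than \<open>10\<^sup>4 / 2304\<close> is required.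
\<close>

definition six_phases :: "complex set" where
  "six_phases = {1, -1, Complex (3/5) (4/5), Complex (3/5) (-4/5), Complex (-3/5) (4/5), Complex (-3/5) (-4/5)}"

lemma card_six_phases: "card six_phases = 6"
  by (simp add: six_phases_def complex_eq_iff)

lemma cmod_six_phases: "z \<in> six_phases \<Longrightarrow> cmod z = 1"
  by (auto simp: six_phases_def cmod_def power2_eq_square)

text \<open>The smallest squared distance is 4/5, which exceeds the square of 4/5.\<close>

lemma six_phases_separated:
  assumes "z \<in> six_phases" "z' \<in> six_phases" "z \<noteq> z'"
  shows "4/5 \<le> cmod (z - z')"
proof -
  have "(4/5)\<^sup>2 \<le> (cmod (z - z'))\<^sup>2"
    using assms unfolding cmod_power2 by (auto simp: six_phases_def power2_eq_square)
  then show ?thesis by (rule power2_le_imp_le) simp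
qed

section \<open>Numerical estimates for the packing constant\<close>

text \<open>The cube lies above its tangent at \<open>a\<close>. This linear bound is used at 3/5,
  7/10 and 4/5, leaving only linear inequalities.\<close>

lemma cube_tangent: "3 * a\<^sup>2 * s - 2 * a ^ 3 \<le> s ^ 3" if "0 \<le> a" "0 \<le> s" for a s :: real
proof -
  have "0 \<le> (s - a)\<^sup>2 * (s + 2 * a)" using that by simp
  then show ?thesis by (simp add: power2_eq_square power3_eq_cube algebra_simps)
qed

text \<open>
  With \<open>\<epsilon> = s\<^sup>2\<close>, this says \<open>\<epsilon> + 2 C \<le> (69/40) 2\<^sup>d \<epsilon> powr (1 - d/2)\<close> in dimension \<open>d = k + 3\<close>.
  The factor \<open>69/40\<close> is a rational number just below the square root of 3, so that the \<open>2 d\<close>-th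
  power is at most \<open>n0 d\<close>.
\<close>

lemma resolvent_const_bound:
  fixes s :: real
  assumes s: "0 < s" "s \<le> 1"
  shows "(s\<^sup>2 + 2 * resolvent_const (1 - s\<^sup>2) (Suc (Suc k))) * s ^ Suc k \<le> 69/40 * 2 ^ (k + 3)"
proof (induction k)
  case 0
  define x where "x = s ^ 3"
  \<comment> \<open>In dimension 3 the bracket of the goal is
    \<open>34 - 39 * s\<^sup>2 + 12 * s ^ 4\<close>.\<close>
  have "34 * s - 39 * x + 12 * (s\<^sup>2 * x) \<le> 69/5"
  proof (cases "s \<le> 4/5")
    case True
    have "s\<^sup>2 \<le> (4/5)\<^sup>2" using True s by (intro power_mono) auto
    then have "s\<^sup>2 * x \<le> 16/25 * x" using s by (intro mult_right_mono) (auto simp: x_def power2_eq_square)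
    moreover have "27/25 * s - 54/125 \<le> x"
      using cube_tangent[of "3/5" s] s by (simp add: x_def power2_eq_square power3_eq_cube)
    ultimately show ?thesis using s by linarith
  next
    case False
    have "s\<^sup>2 * x \<le> 1 * x" using s by (intro mult_right_mono) (auto simp: x_def power_le_one)
    moreover have "48/25 * s - 128/125 \<le> x"
      using cube_tangent[of "4/5" s] s by (simp add: x_def power2_eq_square power3_eq_cube)
    ultimately show ?thesis using s False by linarith
  qed
  then show ?case by (simp add: x_def power2_eq_square power3_eq_cube algebra_simps)
next
  case (Suc k)
  define D where "D = s\<^sup>2 + 2 * resolvent_const (1 - s\<^sup>2) (Suc (Suc k))"
  define P where "P = D * s ^ Suc k"
  define B :: real where "B = 69/40 * 2 ^ (k + 3)"
  have IH: "P \<le> B" using Suc by (simp add: P_def D_def B_def)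
  \<comment> \<open>One more dimension multiplies the quantity by
    \<open>s * (3 - 2 * s\<^sup>2)\<close>, at most 3/2, and adds at most 2; the bound doubles, and
    its slack \<open>B / 2\<close> absorbs the summand.\<close>
  have rec: "s\<^sup>2 + 2 * resolvent_const (1 - s\<^sup>2) (Suc (Suc (Suc k)))
      = (3 - 2 * s\<^sup>2) * D + (2 + 2 * (1 - s\<^sup>2)\<^sup>2)"
    unfolding D_def resolvent_const.simps(2)[of _ "Suc (Suc k)"]
    by (simp add: power2_eq_square algebra_simps)
  have s2: "s\<^sup>2 \<le> 1" using s by (simp add: power_le_one)
  have small: "s ^ Suc (Suc k) * (2 + 2 * (1 - s\<^sup>2)\<^sup>2) \<le> 2"
  proof -
    have "s ^ Suc (Suc k) \<le> s\<^sup>2" using s by (intro power_decreasing) auto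
    then have "s ^ Suc (Suc k) * (2 + 2 * (1 - s\<^sup>2)\<^sup>2) \<le> s\<^sup>2 * (2 + 2 * (1 - s\<^sup>2)\<^sup>2)"
      by (intro mult_right_mono) auto
    also have "\<dots> = 2 - 2 * (1 - s\<^sup>2) * ((s\<^sup>2 - 1/2)\<^sup>2 + 3/4)"
      by (simp add: power2_eq_square algebra_simps)
    also have "\<dots> \<le> 2" using s2 by simp
    finally show ?thesis .
  qed
  \<comment> \<open>The function \<open>s * (3 - 2 * s\<^sup>2)\<close> peaks at the square root of
    1/2, close to 7/10, where the tangent is taken.\<close>
  have gap: "1/2 \<le> 2 - s * (3 - 2 * s\<^sup>2)"
    using cube_tangent[of "7/10" s] s by (simp add: power2_eq_square power3_eq_cube algebra_simps)
  have "B = 69/5 * 2 ^ k" by (simp add: B_def power_add)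
  with two_realpow_ge_one[of k] have B: "8 \<le> B" by linarith
  have "s * (3 - 2 * s\<^sup>2) * P \<le> s * (3 - 2 * s\<^sup>2) * B"
    using s s2 IH by (intro mult_left_mono) auto
  moreover have "1/2 * B \<le> (2 - s * (3 - 2 * s\<^sup>2)) * B"
    using gap B by (intro mult_right_mono) auto
  ultimately have "s * (3 - 2 * s\<^sup>2) * P + 2 \<le> 2 * B"
    using B unfolding left_diff_distrib by linarith
  moreover have "(s\<^sup>2 + 2 * resolvent_const (1 - s\<^sup>2) (Suc (Suc (Suc k)))) * s ^ Suc (Suc k)
      = s * (3 - 2 * s\<^sup>2) * P + s ^ Suc (Suc k) * (2 + 2 * (1 - s\<^sup>2)\<^sup>2)"
    unfolding rec P_def by (simp add: algebra_simps)
  moreover have "69/40 * 2 ^ (Suc k + 3) = 2 * B" by (simp add: B_def power_add)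
  ultimately show ?case using small by linarith
qed

text \<open>The factor 6 is the number of phases.\<close>

lemma packing_bound_le:
  fixes \<epsilon> :: real and k :: nat
  assumes \<epsilon>: "0 < \<epsilon>" "\<epsilon> \<le> 1"
  defines "C \<equiv> resolvent_const (1 - \<epsilon>) (Suc k)"
  defines "d \<equiv> Suc (Suc k)"
  shows "(1 + 2 * C / \<epsilon>) ^ (2 * d) \<le> 6 * (real (n0 d) / \<epsilon> ^ d\<^sup>2)"
proof -
  have C: "1 \<le> C" unfolding C_def using \<epsilon> by (intro resolvent_const_ge_1) simp
  have eq: "(1 + 2 * C / \<epsilon>) ^ (2 * d) = (\<epsilon> + 2 * C) ^ (2 * d) / \<epsilon> ^ (2 * d)"
    using \<epsilon> by (simp add: power_divide[symmetric] add_divide_distrib)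
  show ?thesis
  proof (cases k)
    case 0
    \<comment> \<open>In dimension 2, \<open>C = 5 - 3 * \<epsilon>\<close>, so the base is at most
      10; \<open>n0 2 = 2304\<close> and \<open>10 ^ 4 \<le> 6 * 2304\<close>.\<close>
    have "(\<epsilon> + 2 * C) ^ 4 \<le> 10 ^ 4"
      using \<epsilon> C by (intro power_mono) (simp_all add: C_def 0)
    moreover have "d = 2" by (simp add: d_def 0)
    ultimately show ?thesis unfolding eq using \<epsilon> by (simp add: n0_def divide_simps)
  next
    case (Suc m)
    define s where "s = sqrt \<epsilon>"
    have s: "0 < s" "s \<le> 1" and s2: "s\<^sup>2 = \<epsilon>" using \<epsilon> by (simp_all add: s_def)
    have "(\<epsilon> + 2 * C) * s ^ k \<le> 69/40 * 2 ^ d"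
      using resolvent_const_bound[OF s, of m] unfolding s2 C_def d_def Suc
      by (simp only: numeral_3_eq_3 add_Suc_right add_0_right)
    then have "((\<epsilon> + 2 * C) * s ^ k) ^ (2 * d) \<le> (69/40 * 2 ^ d) ^ (2 * d)"
      using \<epsilon> C s by (intro power_mono) auto
    also have "\<dots> = ((69/40)\<^sup>2 * (2 ^ d)\<^sup>2) ^ d" by (simp only: power_mult power_mult_distrib)
    also have "\<dots> \<le> (3 * 4 ^ d) ^ d"
    proof (rule power_mono)
      have "((2::real) ^ d)\<^sup>2 = 4 ^ d" by (simp flip: power_mult_distrib add: power2_eq_square)
      then show "(69/40)\<^sup>2 * (2 ^ d)\<^sup>2 \<le> (3::real) * 4 ^ d" by (simp add: power2_eq_square)
    qed simp
    also have "\<dots> = real (n0 d)" by (simp add: n0_def power_mult_distrib power2_eq_square flip: power_mult)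
    finally have "(\<epsilon> + 2 * C) ^ (2 * d) * \<epsilon> ^ (k * d) \<le> real (n0 d)"
      unfolding s2[symmetric] by (simp add: power_mult_distrib ac_simps flip: power_mult)
    moreover have "d\<^sup>2 = k * d + 2 * d" by (simp add: d_def power2_eq_square algebra_simps)
    then have "\<epsilon> ^ d\<^sup>2 = \<epsilon> ^ (k * d) * \<epsilon> ^ (2 * d)" by (simp only: power_add)
    ultimately have "(1 + 2 * C / \<epsilon>) ^ (2 * d) \<le> real (n0 d) / \<epsilon> ^ d\<^sup>2"
      unfolding eq using \<epsilon> by (simp add: field_simps)
    moreover have "0 \<le> real (n0 d) / \<epsilon> ^ d\<^sup>2" using \<epsilon> by simp
    ultimately show ?thesis by linarith
  qed
qed

section \<open>The packing argument for the rotated orbit\<close>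

theorem theorem3:
  fixes S :: "(complex^'n^'n) set" and \<epsilon> :: real and n :: nat
  assumes "bounded S"
    and "joint_spectral_radius S = 1"
    and "\<epsilon> > 0"
    and "real n \<ge> \<epsilon> powi (- int (CARD('n)\<^sup>2)) * real (n0 CARD('n))"
  shows "Max ((\<lambda>k. sup_eigenvalue_modulus (prod_set S k)) ` {1..n}) \<ge> 1 - \<epsilon>"
proof (rule ccontr)
  define d where "d = CARD('n)"
  define R where "R = Max ((\<lambda>k. sup_eigenvalue_modulus (prod_set S k)) ` {1..n})"
  assume "\<not> Max ((\<lambda>k. sup_eigenvalue_modulus (prod_set S k)) ` {1..n}) \<ge> 1 - \<epsilon>"
  then have R_less: "R < 1 - \<epsilon>" by (simp add: R_def)
  have n_ge: "real (n0 d) / \<epsilon> ^ d\<^sup>2 \<le> real n"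
    using assms(4) unfolding power_int_minus power_int_of_nat
    by (simp add: d_def divide_inverse mult.commute)
  \<comment> \<open>Positivity of \<open>n\<close> makes the range of the \<open>Max\<close>
    nonempty, and length 1 gives \<open>0 \<le> R\<close>.\<close>
  have "0 < real (n0 d) / \<epsilon> ^ d\<^sup>2" using assms(3) by (simp add: n0_def)
  with n_ge have n: "n > 0" by linarith
  have sup_le: "sup_eigenvalue_modulus (prod_set S k) \<le> R" if "k \<in> {1..n}" for k
    unfolding R_def using that by (intro Max_ge) auto
  have "0 \<le> sup_eigenvalue_modulus (prod_set S 1)"
    unfolding sup_eigenvalue_modulus_def
    by (intro nonneg_Sup_nonneg bdd_above_max_eigenvalue_modulus assms(1))
  with sup_le[of 1] n have R: "0 \<le> R" "R < 1" using R_less assms(3) by auto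
  have spectrum: "cmod l \<le> R" if "l \<in> eigenvalues w" "w \<in> prod_set S k" "k \<in> {1..n}" for l w k
  proof -
    have "cmod l \<le> max_eigenvalue_modulus w" using that(1) by (rule cmod_eigenvalue_le)
    also have "\<dots> \<le> sup_eigenvalue_modulus (prod_set S k)"
      unfolding sup_eigenvalue_modulus_def using that(2)
      by (intro le_nonneg_Sup bdd_above_max_eigenvalue_modulus assms(1)) auto
    also have "\<dots> \<le> R" using that(3) by (rule sup_le)
    finally show ?thesis .
  qed
  \<comment> \<open>\<open>5/8\<close> separates different phases of one point, \<open>R\<close>
    serves dimension 1, and \<open>\<epsilon> / (1 - R)\<close> turns the resolvent bound into the
    separation \<open>\<epsilon> / C\<close>. All three are below 1.\<close>
  define \<beta> where "\<beta> = max (5/8) (max R (\<epsilon> / (1 - R)))"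
  have \<beta>: "0 < \<beta>" "\<beta> < 1" "5/8 \<le> \<beta>" "R \<le> \<beta>"
    using R R_less by (auto simp: \<beta>_def less_max_iff_disj)
  have "\<epsilon> / (1 - R) \<le> \<beta>" by (simp add: \<beta>_def)
  then have \<beta>_\<epsilon>: "\<epsilon> \<le> (1 - R) * \<beta>" using R by (simp add: pos_divide_le_eq mult.commute)
  obtain p K t x where "equivalent_norm p K" and t: "0 < t" "t \<le> 1"
    and contr: "\<And>k (w :: complex^'n^'n) v. w \<in> prod_set S k \<Longrightarrow> t ^ k * p (w *v v) \<le> p v"
    and x_gt: "\<And>i. i \<le> n \<Longrightarrow> \<beta> < p (x i)" and x_le: "\<And>i. i \<le> n \<Longrightarrow> p (x i) \<le> 1"
    and orbit: "\<And>i j. i \<le> j \<Longrightarrow> j \<le> n \<Longrightarrow>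
      \<exists>w\<in>prod_set S (j - i). x j = complex_of_real (t ^ (j - i)) *s (w *v x i)"
    by (rule exists_almost_extremal_orbit[OF assms(1,2) n \<beta>(1,2)]) (rule that)
  interpret equivalent_norm p K by fact
  have phase: "p (u *s v) = p v" if "cmod u = 1" for u v using that by (simp add: scale)
  show False
  proof (cases "d = 1")
    case True
    obtain w where w: "w \<in> prod_set S 1" "x 1 = complex_of_real (t ^ 1) *s (w *v x 0)"
      using orbit[of 0 1] n by auto
    have "p (complex_of_real t *s (w *v x 0)) \<le> R * p (x 0)"
    proof (rule one_dimensional_contraction)
      show "cmod l \<le> R" if "l \<in> eigenvalues w" for l using spectrum[OF that w(1)] n by simp
      show "cmod (complex_of_real t) * p (w *v v) \<le> p v" for v using contr[OF w(1)] t by simp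
    qed (use t R True d_def in auto)
    also have "\<dots> \<le> R * 1" using R x_le by (intro mult_left_mono) auto
    finally have "p (x 1) \<le> R" using w(2) by simp
    with x_gt[of 1] n \<beta>(4) show False by simp
  next
    case False
    have "d > 0" by (simp add: d_def)
    with False have "d = Suc (Suc (d - 2))" by simp
    then obtain k where k: "d = Suc (Suc k)" by blast
    define C where "C = resolvent_const (1 - \<epsilon>) (Suc k)"
    have \<epsilon>: "0 < \<epsilon>" "\<epsilon> \<le> 1" using assms(3) R R_less by auto
    \<comment> \<open>The first bound gives \<open>\<epsilon> / C \<le> 1/2\<close>, and
      \<open>1/2 = 4/5 * 5/8\<close> is guaranteed between different phases of one point.\<close>
    have C: "2 * \<epsilon> \<le> C" "0 < C"
      using resolvent_const_ge_1[of "1 - \<epsilon>" k] \<epsilon> mult_mono[of 1 "3 - 2 * \<epsilon>" 1 "resolvent_const (1 - \<epsilon>) k"]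
      by (auto simp: C_def)
    define I where "I = {0..n} \<times> six_phases"
    define y where "y = (\<lambda>(i, z). z *s x i)"
    have return: "\<epsilon> / C \<le> p (z *s x i - z' *s x j)"
      if ij: "i < j" "j \<le> n" and z: "cmod z = 1" "cmod z' = 1" for i j z z'
    proof -
      obtain w where w: "w \<in> prod_set S (j - i)"
        "x j = complex_of_real (t ^ (j - i)) *s (w *v x i)" using orbit[of i j] ij by auto
      \<comment> \<open>Dividing by the phase \<open>z\<close> turns the difference of two rotated
        points into \<open>x i - c *s (w *v x i)\<close>.\<close>
      define c where "c = z' / z * complex_of_real (t ^ (j - i))"
      have z0: "z \<noteq> 0" "z' \<noteq> 0" using z by auto
      have norm_c: "cmod c = t ^ (j - i)" using z t by (simp add: c_def norm_mult norm_divide norm_power)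
      have "(1 - R) * p (x i) \<le> resolvent_const R (Suc k) * p (x i - c *s (w *v x i))"
      proof (rule return_distance_ge)
        show "c \<noteq> 0" using z0 t by (simp add: c_def)
        show "cmod c \<le> 1" unfolding norm_c using t by (simp add: power_le_one)
        show "cmod c * p (w *v v) \<le> p v" for v unfolding norm_c by (rule contr[OF w(1)])
        show "cmod l \<le> R" if "l \<in> eigenvalues w" for l
          by (rule spectrum[OF that w(1)]) (use ij in auto)
      qed (use R k d_def in auto)
      also have "\<dots> \<le> C * p (x i - c *s (w *v x i))"
        unfolding C_def using R R_less by (intro mult_right_mono resolvent_const_mono) auto
      also have "z *s (x i - c *s (w *v x i)) = z *s x i - z' *s x j"
        using z0 by (simp add: c_def w(2) vec.scale_right_diff_distrib)
      then have "p (x i - c *s (w *v x i)) = p (z *s x i - z' *s x j)" using phase[OF z(1)] by metis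
      finally have "(1 - R) * p (x i) \<le> C * p (z *s x i - z' *s x j)" .
      moreover have "(1 - R) * \<beta> \<le> (1 - R) * p (x i)"
        using x_gt[of i] ij R by (intro mult_left_mono) auto
      ultimately have "\<epsilon> \<le> C * p (z *s x i - z' *s x j)" using \<beta>_\<epsilon> by linarith
      then show ?thesis using C(2) by (simp add: pos_divide_le_eq mult.commute)
    qed
    have "real (card I) \<le> (1 + 2 / (\<epsilon> / C)) ^ (2 * CARD('n))"
    proof (rule card_separated_le)
      show "finite I" by (simp add: I_def six_phases_def)
      show "0 < \<epsilon> / C" using \<epsilon> C by simp
      show "p (y a) \<le> 1" if "a \<in> I" for a
        using that x_le by (auto simp: I_def y_def phase cmod_six_phases)
      fix a b assume ab: "a \<in> I" "b \<in> I" "a \<noteq> b"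
      obtain i z j z' where ij: "a = (i, z)" "b = (j, z')" by (metis surj_pair)
      have le: "i \<le> n" "j \<le> n" and z: "z \<in> six_phases" "z' \<in> six_phases"
        using ab ij by (auto simp: I_def)
      consider "i < j" | "j < i" | "i = j" "z \<noteq> z'" using ab ij by fastforce
      then show "\<epsilon> / C \<le> p (y a - y b)"
      proof cases
        case 1
        then show ?thesis using return[of i j z z'] le z by (simp add: y_def ij cmod_six_phases)
      next
        case 2
        then show ?thesis
          using return[of j i z' z] le z by (simp add: y_def ij cmod_six_phases diff_commute)
      next
        case 3
        have "\<epsilon> / C \<le> 1/2" using C by (simp add: pos_divide_le_eq)
        also have "\<dots> \<le> 4/5 * p (x i)" using x_gt[OF le(1)] \<beta>(3) by simp
        also have "\<dots> \<le> cmod (z - z') * p (x i)"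
          using six_phases_separated[OF z 3(2)] by (intro mult_right_mono) auto
        also have "\<dots> = p (y a - y b)"
          unfolding scale[symmetric] using 3 by (simp add: y_def ij vec.scale_left_diff_distrib)
        finally show ?thesis .
      qed
    qed
    also have "\<dots> \<le> 6 * (real (n0 d) / \<epsilon> ^ d\<^sup>2)"
      using packing_bound_le[OF \<epsilon>, of k] by (simp add: C_def k flip: d_def)
    also have "\<dots> \<le> 6 * real n" using n_ge by simp
    finally have "real (card I) \<le> 6 * real n" .
    \<comment> \<open>The times 0 to \<open>n\<close> number \<open>n + 1\<close>, one more than the
      packing bound permits.\<close>
    moreover have "card I = 6 * (n + 1)"
      unfolding I_def card_cartesian_product card_six_phases by simp
    ultimately show False by simp
  qed
qed

end
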